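(* Consider the DePa order-maintenance algorithm (described in the context) running alongside the execution of a nested fork-join program, at an arbitrary moment of the execution. Let $v$ be the current vertex of some leaf task of the task tree at that moment. Then for any other vertex $u$ of the computation dag, the DePa query on $(u,v)$ reports that $u$ precedes $v$ if and only if $u\preccurlyeq v$, i.e. if and only if there is a directed path from $u$ to $v$ in the computation dag.
   Context: **Fork-join programs and task trees.** A fork-join program executes tasks organized in a dynamic rooted task tree, initially a single root task. At any moment any leaf task may *fork*, creating two child tasks (left and right); the parent is suspended while the children execute. When both children have completed they *join* with the parent: the children are deleted from the tree and the parent resumes. Tasks at leaves are *running*; tasks at internal nodes are *suspended*. **Computation dag.** Each vertex represents a maximal sequence of executed instructions of a task uninterrupted by a fork or join. The dag is built during execution, starting from one vertex (the root task's current vertex). When a task with current vertex $u$ forks, two new vertices $v,w$ are created with edges $u\to v$, $u\to w$; $v$ and $w$ are the current vertices of the left and right child. When two sibling tasks with current vertices $u,v$ join, one new vertex $x$ is created with edges $u\to x$, $v\to x$, and $x$ becomes the current vertex of the resumed parent. Write $u\preccurlyeq v$ ("$u$ precedes $v$") if there is a (possibly empty) directed path from $u$ to $v$. **Dag-depth and fork-path.** The dag-depth $D(v)$ is the length of the longest directed path ending at $v$. The fork-path $P(v)$ is a finite word over $\{\mathsf L,\mathsf R\}$: the initial vertex has the empty word; if $u$ forks into left $v$ and right $w$, then $P(v)=P(u)\mathsf L$ and $P(w)=P(u)\mathsf R$; if $u,v$ join into $x$, then $P(u),P(v)$ are $p\,\mathsf L$ and $p\,\mathsf R$ for a common $p$,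 and $P(x)=p$. Thus at a fork $D(v)=D(w)=1+D(u)$, and at a join $D(x)=1+\max(D(u),D(v))$. $\mathrm{LCP}(p_1,p_2)$ denotes the longest common prefix. **DePa algorithm.** It stores for each vertex its identifier $(D(v),P(v))$, computed by the local rules above, and maintains a global map $\mathtt{SuspendedDepths}$ from fork-paths to dag-depths. - *Fork* of a task with current vertex $u$: set $\mathtt{SuspendedDepths}[P(u)]:=D(u)$; create identifiers of the two new vertices. - *Join* of two siblings with paths $p\,\mathsf L$, $p\,\mathsf R$: create the identifier of the new vertex of the parent (with fork-path $p$) and remove the entry for key $p$ from $\mathtt{SuspendedDepths}$. - *Query* $(u,v)$, with $v$ the current vertex of a leaf task: let $p=\mathrm{LCP}(P(u),P(v))$. If $p=P(v)$, report that $u$ precedes $v$ iff $D(u)\le D(v)$. Otherwise report that $u$ precedes $v$ iff $D(u)\le\mathtt{SuspendedDepths}[p]$. *)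

theory Defs
  imports Main "HOL-Library.Sublist"
begin

section \<open>Execution of fork-join programs\<close>

text \<open>
  Every node of the task tree carries the current vertex of its task. For an internal node
  (suspended task) this is the vertex at which the task forked; it is replaced by a fresh
  vertex when the children join.
\<close>

datatype 'v task_tree =
    Leaf 'v
  | Node 'v "'v task_tree" "'v task_tree"

fun running_vertices :: "'v task_tree \<Rightarrow> 'v set" where
  "running_vertices (Leaf u) = {u}"
| "running_vertices (Node u l r) = running_vertices l \<union> running_vertices r"

inductive tree_fork :: "'v \<Rightarrow> 'v \<Rightarrow> 'v \<Rightarrow> 'v task_tree \<Rightarrow> 'v task_tree \<Rightarrow> bool"
  for u v w where
  fork_here: "tree_fork u v w (Leaf u) (Node u (Leaf v) (Leaf w))"
| fork_left: "tree_fork u v w l l' \<Longrightarrow> tree_fork u v w (Node y l r) (Node y l' r)"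
| fork_right: "tree_fork u v w r r' \<Longrightarrow> tree_fork u v w (Node y l r) (Node y l r')"

inductive tree_join :: "'v \<Rightarrow> 'v \<Rightarrow> 'v \<Rightarrow> 'v task_tree \<Rightarrow> 'v task_tree \<Rightarrow> bool"
  for u v x where
  join_here: "tree_join u v x (Node y (Leaf u) (Leaf v)) (Leaf x)"
| join_left: "tree_join u v x l l' \<Longrightarrow> tree_join u v x (Node y l r) (Node y l' r)"
| join_right: "tree_join u v x r r' \<Longrightarrow> tree_join u v x (Node y l r) (Node y l r')"

record 'v execution =
  tasks :: "'v task_tree"
  verts :: "'v set"
  edges :: "('v \<times> 'v) set"

text \<open>
  \<open>Fork u v w\<close>: vertex \<open>u\<close> forks into the left child \<open>v\<close> and the right child \<open>w\<close>.
  \<open>Join u v x\<close>: the sibling vertices \<open>u\<close> (left) and \<open>v\<close> (right) join into \<open>x\<close>.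
\<close>

datatype 'v event = Fork 'v 'v 'v | Join 'v 'v 'v

definition initial_execution :: "'v \<Rightarrow> 'v execution" where
  "initial_execution r = \<lparr>tasks = Leaf r, verts = {r}, edges = {}\<rparr>"

text \<open>
  The program itself is left arbitrary: any leaf task may fork at any time, and any two sibling
  leaf tasks may complete and join at any time. A completed task that waits for its sibling
  remains a leaf.
\<close>

inductive execution_step :: "'v event \<Rightarrow> 'v execution \<Rightarrow> 'v execution \<Rightarrow> bool" where
  step_fork: "\<lbrakk>tree_fork u v w (tasks X) t; v \<notin> verts X; w \<notin> verts X; v \<noteq> w\<rbrakk> \<Longrightarrow>
    execution_step (Fork u v w) X
      \<lparr>tasks = t, verts = verts X \<union> {v, w}, edges = edges X \<union> {(u, v), (u, w)}\<rparr>"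
| step_join: "\<lbrakk>tree_join u v x (tasks X) t; x \<notin> verts X\<rbrakk> \<Longrightarrow>
    execution_step (Join u v x) X
      \<lparr>tasks = t, verts = verts X \<union> {x}, edges = edges X \<union> {(u, x), (v, x)}\<rparr>"

definition precedes :: "'v execution \<Rightarrow> 'v \<Rightarrow> 'v \<Rightarrow> bool" where
  "precedes X u v \<longleftrightarrow> (u, v) \<in> (edges X)\<^sup>*"

definition dag_depth :: "'v execution \<Rightarrow> 'v \<Rightarrow> nat" where
  "dag_depth X v = Max {n. \<exists>u. (u, v) \<in> edges X ^^ n}"


section \<open>The DePa algorithm\<close>

datatype dir = L | R

text \<open>
  Fork-paths are read from left to right, so a fork appends a letter at the end of the list.
  The algorithm sees only the events, neither the task tree nor the dag. The values of \<open>depth\<close>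
  and \<open>fork_path\<close> at vertices that have not been created yet are meaningless; they are
  overwritten when the vertex is created.
\<close>

record 'v depa =
  depth :: "'v \<Rightarrow> nat"
  fork_path :: "'v \<Rightarrow> dir list"
  suspended_depths :: "dir list \<rightharpoonup> nat"

definition initial_depa :: "'v \<Rightarrow> 'v depa" where
  "initial_depa r = \<lparr>depth = (\<lambda>_. undefined)(r := 0), fork_path = (\<lambda>_. undefined)(r := []),
     suspended_depths = Map.empty\<rparr>"

text \<open>
  At a join the fork-paths of \<open>u\<close> and \<open>v\<close> are \<open>p @ [L]\<close> and \<open>p @ [R]\<close>
  (lemma \<open>join_fork_paths\<close> below); the common part \<open>p\<close> is recovered by \<open>butlast\<close>.
\<close>

fun depa_update :: "'v event \<Rightarrow> 'v depa \<Rightarrow> 'v depa" where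
  "depa_update (Fork u v w) A =
     \<lparr>depth = (depth A)(v := 1 + depth A u, w := 1 + depth A u),
      fork_path = (fork_path A)(v := fork_path A u @ [L], w := fork_path A u @ [R]),
      suspended_depths = (suspended_depths A)(fork_path A u \<mapsto> depth A u)\<rparr>"
| "depa_update (Join u v x) A =
     (let p = butlast (fork_path A u) in
      \<lparr>depth = (depth A)(x := 1 + max (depth A u) (depth A v)),
       fork_path = (fork_path A)(x := p),
       suspended_depths = (suspended_depths A)(p := None)\<rparr>)"

text \<open>The result \<open>None\<close> stands for a failed lookup in \<open>suspended_depths\<close>.\<close>

definition depa_query :: "'v depa \<Rightarrow> 'v \<Rightarrow> 'v \<Rightarrow> bool option" where
  "depa_query A u v =
     (let p = longest_common_prefix (fork_path A u) (fork_path A v) in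
      if p = fork_path A v then Some (depth A u \<le> depth A v)
      else map_option (\<lambda>d. depth A u \<le> d) (suspended_depths A p))"

inductive depa_run :: "'v execution \<Rightarrow> 'v depa \<Rightarrow> bool" where
  run_init: "depa_run (initial_execution r) (initial_depa r)"
| run_step: "\<lbrakk>depa_run X A; execution_step e X X'\<rbrakk> \<Longrightarrow> depa_run X' (depa_update e A)"


section \<open>The stored identifiers are the dag-depth and the fork-path\<close>

fun tree_paths_ok :: "'v set \<Rightarrow> ('v \<Rightarrow> dir list) \<Rightarrow> dir list \<Rightarrow> 'v task_tree \<Rightarrow> bool" where
  "tree_paths_ok V P q (Leaf u) \<longleftrightarrow> u \<in> V \<and> P u = q"
| "tree_paths_ok V P q (Node u l r) \<longleftrightarrow>
     u \<in> V \<and> P u = q \<and> tree_paths_ok V P (q @ [L]) l \<and> tree_paths_ok V P (q @ [R]) r"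

lemma tree_paths_ok_mono:
  "\<lbrakk>tree_paths_ok V P q t; V \<subseteq> V'; \<And>y. y \<in> V \<Longrightarrow> P' y = P y\<rbrakk> \<Longrightarrow> tree_paths_ok V' P' q t"
  by (induction t arbitrary: q) auto

lemma tree_paths_ok_fork:
  assumes "tree_fork u v w t t'" "tree_paths_ok V P q t" "v \<notin> V" "w \<notin> V" "v \<noteq> w"
  shows "u \<in> V \<and>
    tree_paths_ok (V \<union> {v, w}) (P(v := P u @ [L], w := P u @ [R])) q t'"
proof -
  define P' where "P' = P(v := P u @ [L], w := P u @ [R])"
  have P': "\<And>y. y \<in> V \<Longrightarrow> P' y = P y" "P' v = P u @ [L]" "P' w = P u @ [R]"
    using assms by (auto simp: P'_def)
  have old: "tree_paths_ok (V \<union> {v, w}) P' q t" if "tree_paths_ok V P q t" for q t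
    by (rule tree_paths_ok_mono[OF that]) (use P' in auto)
  show ?thesis
    unfolding P'_def[symmetric] using assms(1,2)
  proof (induction arbitrary: q rule: tree_fork.induct)
    case fork_here
    then show ?case using P' by auto
  next
    case (fork_left l l' y r)
    then show ?case using old[of "q @ [R]" r] P' by auto
  next
    case (fork_right r r' y l)
    then show ?case using old[of "q @ [L]" l] P' by auto
  qed
qed

lemma tree_paths_ok_join:
  assumes "tree_join u v x t t'" "tree_paths_ok V P q t" "x \<notin> V"
  shows "u \<in> V \<and> v \<in> V \<and> (\<exists>p. P u = p @ [L] \<and> P v = p @ [R]) \<and>
    tree_paths_ok (V \<union> {x}) (P(x := butlast (P u))) q t'"
proof -
  define P' where "P' = P(x := butlast (P u))"
  have P': "\<And>y. y \<in> V \<Longrightarrow> P' y = P y" "P' x = butlast (P u)"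
    using assms by (auto simp: P'_def)
  have old: "tree_paths_ok (V \<union> {x}) P' q t" if "tree_paths_ok V P q t" for q t
    by (rule tree_paths_ok_mono[OF that]) (use P' in auto)
  show ?thesis
    unfolding P'_def[symmetric] using assms(1,2)
  proof (induction arbitrary: q rule: tree_join.induct)
    case join_here
    then show ?case using P' by auto
  next
    case (join_left l l' y r)
    then show ?case using old[of "q @ [R]" r] P' by auto
  next
    case (join_right r r' y l)
    then show ?case using old[of "q @ [L]" l] P' by auto
  qed
qed

definition is_depth :: "('v \<times> 'v) set \<Rightarrow> 'v \<Rightarrow> nat \<Rightarrow> bool" where
  "is_depth E v d \<longleftrightarrow> (\<exists>u. (u, v) \<in> E ^^ d) \<and> (\<forall>n u. (u, v) \<in> E ^^ n \<longrightarrow> n \<le> d)"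

lemma relpow_old:
  assumes "E \<subseteq> V \<times> V" "N \<subseteq> V \<times> W" "V \<inter> W = {}" "v \<in> V"
  shows "(u, v) \<in> (E \<union> N) ^^ n \<longleftrightarrow> (u, v) \<in> E ^^ n"
  using assms(4)
proof (induction n arbitrary: v)
  case (Suc n)
  have "(y, v) \<in> E \<union> N \<longleftrightarrow> (y, v) \<in> E" for y
    using assms Suc.prems by blast
  moreover have "y \<in> V" if "(y, v) \<in> E" for y
    using assms that by blast
  ultimately show ?case
    using Suc.IH by (auto simp: relcomp_unfold)
qed simp

lemma is_depth_old:
  assumes "E \<subseteq> V \<times> V" "N \<subseteq> V \<times> W" "V \<inter> W = {}" "v \<in> V" "is_depth E v d"
  shows "is_depth (E \<union> N) v d"
  using assms(5) unfolding is_depth_def relpow_old[OF assms(1-4)] .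

lemma is_depth_new:
  assumes "E \<subseteq> V \<times> V" "N \<subseteq> V \<times> W" "V \<inter> W = {}" "x \<in> W"
    and "\<And>y. (y, x) \<in> N \<longleftrightarrow> y = a \<or> y = b"
    and "is_depth E a d" "is_depth E b e"
  shows "is_depth (E \<union> N) x (1 + max d e)"
proof -
  have ab: "a \<in> V" "b \<in> V"
    using assms(2,5) by blast+
  have into: "(y, x) \<in> E \<union> N \<longleftrightarrow> y = a \<or> y = b" for y
    using assms(1,3,4,5) by blast
  have a: "is_depth (E \<union> N) a d" and b: "is_depth (E \<union> N) b e"
    using is_depth_old[OF assms(1-3)] ab assms(6,7) by auto
  have "\<exists>u. (u, x) \<in> (E \<union> N) ^^ Suc (max d e)"
    using a b into unfolding is_depth_def max_def by (auto simp del: Un_iff)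
  moreover have "n \<le> Suc (max d e)" if "(u, x) \<in> (E \<union> N) ^^ n" for n u
  proof (cases n)
    case (Suc m)
    then obtain y where y: "(u, y) \<in> (E \<union> N) ^^ m" "(y, x) \<in> E \<union> N"
      using \<open>(u, x) \<in> (E \<union> N) ^^ n\<close> by (meson relpow_Suc_E)
    then have "m \<le> d \<or> m \<le> e"
      using into a b unfolding is_depth_def by metis
    then show ?thesis
      using Suc by auto
  qed simp
  ultimately show ?thesis
    unfolding is_depth_def by auto
qed

lemma depa_run_invariant:
  assumes "depa_run X A"
  shows "edges X \<subseteq> verts X \<times> verts X \<and>
    tree_paths_ok (verts X) (fork_path A) [] (tasks X) \<and>
    (\<forall>v \<in> verts X. is_depth (edges X) v (depth A v))"
  using assms
proof (induction rule: depa_run.induct)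
  case (run_init r)
  have "n = 0" if "(u, r) \<in> {} ^^ n" for n and u :: 'a
    using that by (cases n) auto
  then show ?case
    by (auto simp: initial_execution_def initial_depa_def is_depth_def)
next
  case (run_step X A e X')
  then have E: "edges X \<subseteq> verts X \<times> verts X"
    and T: "tree_paths_ok (verts X) (fork_path A) [] (tasks X)"
    and D: "\<And>v. v \<in> verts X \<Longrightarrow> is_depth (edges X) v (depth A v)"
    by auto
  from run_step.hyps(2) show ?case
  proof cases
    case (step_fork u v w t)
    note T' = tree_paths_ok_fork[OF step_fork(3) T step_fork(4-6)]
    then have u: "u \<in> verts X" ..
    let ?N = "{(u, v), (u, w)}"
    have N: "?N \<subseteq> verts X \<times> {v, w}" "verts X \<inter> {v, w} = {}"
      using u step_fork by auto
    have "is_depth (edges X \<union> ?N) y (depth (depa_update e A) y)"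
      if "y \<in> verts X \<union> {v, w}" for y
    proof (cases "y \<in> verts X")
      case True
      then show ?thesis
        using is_depth_old[OF E N True D] N(2) step_fork(1) by auto
    next
      case False
      then have y: "y \<in> {v, w}"
        using that by blast
      then have "is_depth (edges X \<union> ?N) y (1 + max (depth A u) (depth A u))"
        by (intro is_depth_new[OF E N y, of u u] D u) auto
      then show ?thesis
        using y step_fork(1) by auto
    qed
    then have "\<forall>y \<in> verts X'. is_depth (edges X') y (depth (depa_update e A) y)"
      unfolding step_fork(2) by simp
    moreover have "edges X' \<subseteq> verts X' \<times> verts X'"
      unfolding step_fork(2) using E N by auto
    moreover have "tree_paths_ok (verts X') (fork_path (depa_update e A)) [] (tasks X')"
      unfolding step_fork(1,2) using T' by (simp del: fun_upd_apply Un_insert_right)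
    ultimately show ?thesis
      by blast
  next
    case (step_join u v x t)
    note T' = tree_paths_ok_join[OF step_join(3) T step_join(4)]
    then have uv: "u \<in> verts X" "v \<in> verts X"
      by auto
    let ?N = "{(u, x), (v, x)}"
    have N: "?N \<subseteq> verts X \<times> {x}" "verts X \<inter> {x} = {}"
      using uv step_join by auto
    have "is_depth (edges X \<union> ?N) y (depth (depa_update e A) y)"
      if "y \<in> verts X \<union> {x}" for y
    proof (cases "y \<in> verts X")
      case True
      then show ?thesis
        using is_depth_old[OF E N True D] N(2) step_join(1) by (auto simp: Let_def)
    next
      case False
      then have y: "y \<in> {x}"
        using that by blast
      then have "is_depth (edges X \<union> ?N) y (1 + max (depth A u) (depth A v))"
        by (intro is_depth_new[OF E N y, of u v] D uv) auto
      then show ?thesis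
        using y step_join(1) by (auto simp: Let_def)
    qed
    then have "\<forall>y \<in> verts X'. is_depth (edges X') y (depth (depa_update e A) y)"
      unfolding step_join(2) by simp
    moreover have "edges X' \<subseteq> verts X' \<times> verts X'"
      unfolding step_join(2) using E N by auto
    moreover have "tree_paths_ok (verts X') (fork_path (depa_update e A)) [] (tasks X')"
      unfolding step_join(1,2) using T' by (simp add: Let_def del: fun_upd_apply Un_insert_right)
    ultimately show ?thesis
      by blast
  qed
qed

theorem depth_eq_dag_depth:
  assumes "depa_run X A" "v \<in> verts X"
  shows "depth A v = dag_depth X v"
proof -
  have "is_depth (edges X) v (depth A v)"
    using depa_run_invariant assms by blast
  then have ex: "\<exists>u. (u, v) \<in> edges X ^^ depth A v"
    and le: "\<And>n u. (u, v) \<in> edges X ^^ n \<Longrightarrow> n \<le> depth A v"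
    unfolding is_depth_def by blast+
  have "finite {n. \<exists>u. (u, v) \<in> edges X ^^ n}"
    by (rule finite_subset[of _ "{..depth A v}"]) (use le in blast)+
  then have "Max {n. \<exists>u. (u, v) \<in> edges X ^^ n} = depth A v"
    by (rule Max_eqI) (use le ex in blast)+
  then show ?thesis
    by (simp add: dag_depth_def)
qed

theorem join_fork_paths:
  assumes "depa_run X A" "execution_step (Join u v x) X X'"
  shows "\<exists>p. fork_path A u = p @ [L] \<and> fork_path A v = p @ [R]"
  using assms(2)
proof cases
  case (step_join t)
  then show ?thesis
    using tree_paths_ok_join[of u v x "tasks X" t "verts X" "fork_path A" "[]"]
      depa_run_invariant[OF assms(1)] by blast
qed

end

theory Submission
  imports Defs
begin

text \<open>
  If a suspended task with current vertex \<open>y\<close> has fork-path \<open>q\<close>, then the vertices with fork-path \<open>q\<close>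
  precede \<open>y\<close>, and a vertex whose fork-path properly extends \<open>q\<close> either precedes \<open>y\<close> or was created
  after the fork of \<open>y\<close>. In the latter case it is a strict descendant of \<open>y\<close> and, before the join,
  precedes no running vertex on the other side. As depth is strictly increasing along the dag,
  comparing with the depth of \<open>y\<close> tells the two cases apart. Below a leaf there are no pending forks,
  so every vertex whose fork-path extends that of a running vertex \<open>v\<close> precedes \<open>v\<close>.
\<close>

section \<open>The order invariant on the task tree\<close>

definition separated :: "'v execution \<Rightarrow> 'v depa \<Rightarrow> 'v \<Rightarrow> dir list \<Rightarrow> 'v task_tree \<Rightarrow> bool" where
  "separated X A y p s \<longleftrightarrow> (\<forall>x \<in> verts X. prefix p (fork_path A x) \<longrightarrow>
     precedes X x y \<or> precedes X y x \<and> x \<noteq> y \<and> (\<forall>z \<in> running_vertices s. \<not> precedes X x z))"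

text \<open>Fork-paths are not unique: a task that joins and forks again reuses the paths of its
  former children. Hence the conditions range over all of \<open>verts X\<close>, deleted tasks
  included, and the alternative \<open>precedes X x y\<close> in \<open>separated\<close> covers the
  vertices of earlier forks. Each \<open>separated\<close> conjunct pairs the fork-path of one child
  with the subtree of the other.\<close>

fun tree_order_ok :: "'v execution \<Rightarrow> 'v depa \<Rightarrow> dir list \<Rightarrow> 'v task_tree \<Rightarrow> bool" where
  "tree_order_ok X A q (Leaf u) \<longleftrightarrow> u \<in> verts X \<and> fork_path A u = q \<and>
     (\<forall>x \<in> verts X. prefix q (fork_path A x) \<longrightarrow> precedes X x u)"
| "tree_order_ok X A q (Node y l r) \<longleftrightarrow> y \<in> verts X \<and> fork_path A y = q \<and>
     suspended_depths A q = Some (depth A y) \<and>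
     (\<forall>x \<in> verts X. fork_path A x = q \<longrightarrow> precedes X x y) \<and>
     (\<forall>z \<in> running_vertices l \<union> running_vertices r. precedes X y z) \<and>
     separated X A y (q @ [L]) r \<and> separated X A y (q @ [R]) l \<and>
     tree_order_ok X A (q @ [L]) l \<and> tree_order_ok X A (q @ [R]) r"

lemma precedes_refl: "precedes X u u"
  by (simp add: precedes_def)

lemma precedes_trans: "precedes X u v \<Longrightarrow> precedes X v w \<Longrightarrow> precedes X u w"
  unfolding precedes_def by (rule rtrancl_trans)

lemma prefix_cases_dir:
  assumes "prefix q s"
  obtains "s = q" | "prefix (q @ [L]) s" | "prefix (q @ [R]) s"
proof -
  from assms obtain zs where s: "s = q @ zs"
    by (auto simp: prefix_def)
  show ?thesis
  proof (cases zs)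
    case Nil
    then show ?thesis using s that(1) by simp
  next
    case (Cons d ds)
    then show ?thesis using s that(2,3) by (cases d) (auto simp: prefix_def)
  qed
qed

lemma not_prefix_snoc_self: "\<not> prefix (q @ [d]) q"
  by (auto simp: prefix_def)

lemma running_vertices_ok:
  assumes "tree_order_ok X A q t" "z \<in> running_vertices t"
  shows "z \<in> verts X \<and> prefix q (fork_path A z)"
  using assms by (induction t arbitrary: q) (auto dest: append_prefixD)

text \<open>
  Both kinds of events add the vertices \<open>N\<close> and the edges \<open>U \<times> N\<close>: a fork of \<open>u\<close> into \<open>v\<close> and \<open>w\<close>
  has \<open>U = {u}\<close> and \<open>N = {v, w}\<close>, a join of \<open>u\<close> and \<open>v\<close> into \<open>x\<close> has \<open>U = {u, v}\<close> and \<open>N = {x}\<close>.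
  The word \<open>c\<close> is the fork-path of the task that forks or resumes.
\<close>

locale dag_extension =
  fixes X X' :: "'v execution" and A A' :: "'v depa" and U N :: "'v set" and c :: "dir list"
  assumes edges_verts: "edges X \<subseteq> verts X \<times> verts X"
    and U_verts: "U \<subseteq> verts X" and U_nonempty: "U \<noteq> {}"
    and N_fresh: "verts X \<inter> N = {}"
    and verts': "verts X' = verts X \<union> N"
    and edges': "edges X' = edges X \<union> U \<times> N"
    and fork_path_old: "x \<in> verts X \<Longrightarrow> fork_path A' x = fork_path A x"
    and depth_old: "x \<in> verts X \<Longrightarrow> depth A' x = depth A x"
    and fork_path_new: "x \<in> N \<Longrightarrow> prefix c (fork_path A' x)"
    and suspended_old: "s \<noteq> c \<Longrightarrow> suspended_depths A' s = suspended_depths A s"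
begin

section \<open>Reachability after one event\<close>

text \<open>Every added edge ends in a fresh vertex, and old edges join old vertices, so no path to
  an old vertex uses an added edge.\<close>

lemma precedes_old:
  assumes "b \<in> verts X"
  shows "precedes X' a b \<longleftrightarrow> precedes X a b"
proof -
  have "U \<times> N \<subseteq> verts X \<times> N"
    using U_verts by auto
  then show ?thesis
    unfolding precedes_def edges' rtrancl_power
    using relpow_old[OF edges_verts _ N_fresh assms] by blast
qed

lemma not_precedes_new_old:
  assumes "a \<in> N" "b \<in> verts X"
  shows "\<not> precedes X' a b"
proof
  assume "precedes X' a b"
  then have "(a, b) \<in> (edges X)\<^sup>*"
    using precedes_old assms(2) by (simp add: precedes_def)
  then have "a = b \<or> a \<in> verts X"
    using edges_verts by (auto elim: converse_rtranclE)
  then show False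
    using assms N_fresh by auto
qed

lemma not_precedes_new_new:
  \<comment> \<open>This keeps the two children of a fork apart: the last edge of such a path would
    start at an old vertex, which no new vertex reaches.\<close>
  assumes "a \<in> N" "b \<in> N" "a \<noteq> b"
  shows "\<not> precedes X' a b"
proof
  assume "precedes X' a b"
  then obtain z where "precedes X' a z" "(z, b) \<in> edges X'"
    using assms(3) unfolding precedes_def by (auto elim: rtranclE)
  moreover from this have "z \<in> verts X"
    using edges_verts edges' U_verts by auto
  ultimately show False
    using not_precedes_new_old assms(1) by blast
qed

lemma precedes_new:
  assumes "a \<in> verts X" "b \<in> N"
  shows "precedes X' a b \<longleftrightarrow> (\<exists>z \<in> U. precedes X a z)"
proof
  assume "precedes X' a b"
  moreover have "a \<noteq> b"
    using assms N_fresh by auto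
  ultimately obtain z where z: "precedes X' a z" "(z, b) \<in> edges X'"
    unfolding precedes_def by (auto elim: rtranclE)
  then have "z \<in> U"
    using assms N_fresh edges_verts edges' by auto
  then show "\<exists>z \<in> U. precedes X a z"
    using z(1) precedes_old U_verts by blast
next
  assume "\<exists>z \<in> U. precedes X a z"
  then obtain z where z: "z \<in> U" "precedes X' a z"
    using precedes_old U_verts by blast
  then have "precedes X' z b"
    using assms(2) unfolding precedes_def edges' by auto
  with z(2) show "precedes X' a b"
    by (rule precedes_trans)
qed

section \<open>The invariant beside and above the place of an event\<close>

text \<open>As \<open>p\<close> and \<open>c\<close> are incomparable, no new fork-path extends
  \<open>p\<close>, so only old vertices are concerned, and between these nothing changes.\<close>

lemma separated_frame:
  assumes "separated X A y p s" "y \<in> verts X" "\<not> prefix p c" "\<not> prefix c p"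
    and "running_vertices s \<subseteq> verts X"
  shows "separated X' A' y p s"
proof -
  have "\<not> prefix p (fork_path A' x)" if "x \<in> N" for x
    using fork_path_new[OF that] assms(3,4) prefix_same_cases by blast
  moreover have "z \<in> verts X" if "z \<in> running_vertices s" for z
    using that assms(5) by blast
  ultimately show ?thesis
    using assms(1,2) unfolding separated_def verts'
    by (metis UnE fork_path_old precedes_old)
qed

lemma tree_order_ok_frame:
  assumes "tree_order_ok X A q t" "\<not> prefix q c" "\<not> prefix c q"
  shows "tree_order_ok X' A' q t"
  using assms
proof (induction t arbitrary: q)
  case (Leaf u)
  have "\<not> prefix q (fork_path A' x)" if "x \<in> N" for x
    using fork_path_new[OF that] Leaf.prems(2,3) prefix_same_cases by blast
  then show ?case
    using Leaf.prems(1) by (auto simp: verts' fork_path_old precedes_old)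
next
  case (Node y l r)
  have incomparable: "\<not> prefix (q @ [d]) c" "\<not> prefix c (q @ [d])" for d
    using Node.prems(2,3) by (auto dest: append_prefixD)
  have run: "running_vertices l \<subseteq> verts X" "running_vertices r \<subseteq> verts X"
    using Node.prems(1) running_vertices_ok by fastforce+
  have "fork_path A' x \<noteq> q" if "x \<in> N" for x
    using fork_path_new[OF that] Node.prems(3) by blast
  moreover have "q \<noteq> c"
    using Node.prems(2) by auto
  moreover have "precedes X' y z" if "z \<in> running_vertices l \<union> running_vertices r" for z
    using that Node.prems(1) run precedes_old by auto
  ultimately show ?case
    using Node incomparable separated_frame run
    by (auto simp: verts' fork_path_old depth_old precedes_old suspended_old)
qed

text \<open>Serves an event on the side of \<open>p\<close>, where the sibling subtree
  \<open>s\<close> stays as it is. The new vertices descend from \<open>y\<close> through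
  \<open>U\<close> and reach no old vertex, so they satisfy the second alternative.\<close>

lemma separated_extend_near:
  assumes "separated X A y p s" "y \<in> verts X" "running_vertices s \<subseteq> verts X"
    and "\<And>z. z \<in> U \<Longrightarrow> precedes X y z"
  shows "separated X' A' y p s"
  unfolding separated_def
proof (intro ballI impI)
  fix x assume x: "x \<in> verts X'" "prefix p (fork_path A' x)"
  show "precedes X' x y \<or>
    precedes X' y x \<and> x \<noteq> y \<and> (\<forall>z \<in> running_vertices s. \<not> precedes X' x z)"
  proof (cases "x \<in> verts X")
    case True
    then show ?thesis
      using x(2) assms(1-3) unfolding separated_def
      by (metis fork_path_old precedes_old subsetD)
  next
    case False
    then have N: "x \<in> N"
      using x(1) verts' by auto
    then have "precedes X' y x"
      using precedes_new assms(2,4) U_nonempty by blast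
    moreover have "\<forall>z \<in> running_vertices s. \<not> precedes X' x z"
      using N not_precedes_new_old assms(3) by blast
    ultimately show ?thesis
      using False assms(2) by blast
  qed
qed

text \<open>Serves an event inside the sibling subtree \<open>s\<close>. No new fork-path extends
  \<open>p\<close>, and an old vertex reaches a new one only through \<open>U\<close>, whose members
  were running in \<open>s\<close> and are therefore already excluded.\<close>

lemma separated_extend_far:
  assumes "separated X A y p s" "y \<in> verts X" "running_vertices s \<subseteq> verts X"
    and "\<not> prefix p c" "\<not> prefix c p"
    and "U \<subseteq> running_vertices s" "running_vertices s' \<subseteq> running_vertices s \<union> N"
  shows "separated X' A' y p s'"
  unfolding separated_def
proof (intro ballI impI)
  fix x assume x: "x \<in> verts X'" "prefix p (fork_path A' x)"
  then have "x \<notin> N"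
    using fork_path_new assms(4,5) prefix_same_cases by blast
  then have V: "x \<in> verts X"
    using x(1) verts' by auto
  then consider "precedes X x y"
    | "precedes X y x" "x \<noteq> y" "\<forall>z \<in> running_vertices s. \<not> precedes X x z"
    using x(2) assms(1) unfolding separated_def by (metis fork_path_old)
  then show "precedes X' x y \<or>
    precedes X' y x \<and> x \<noteq> y \<and> (\<forall>z \<in> running_vertices s'. \<not> precedes X' x z)"
  proof cases
    case 1
    then show ?thesis using precedes_old assms(2) by blast
  next
    case 2
    have "\<not> precedes X' x z" if "z \<in> running_vertices s'" for z
    proof (cases "z \<in> N")
      case True
      then show ?thesis using precedes_new[OF V] 2(3) assms(6) by blast
    next
      case False
      then show ?thesis using that assms(3,7) precedes_old 2(3) by blast
    qed
    then show ?thesis using 2 V precedes_old by blast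
  qed
qed

text \<open>The inductive step common to forks and joins. The letter \<open>d\<close> tells which
  child contains the event, and \<open>s\<close> becomes \<open>s'\<close> there; the other subtree
  is handled by the frame lemma.\<close>

lemma tree_order_ok_extend_node:
  assumes "tree_order_ok X A q (Node y l r)" "prefix (q @ [d]) c"
    and "(d = L \<and> r' = r \<and> s = l \<and> s' = l') \<or> (d = R \<and> l' = l \<and> s = r \<and> s' = r')"
    and "tree_order_ok X' A' (q @ [d]) s'"
    and "U \<subseteq> running_vertices s" "running_vertices s' \<subseteq> running_vertices s \<union> N"
  shows "tree_order_ok X' A' q (Node y l' r')"
proof -
  have y: "y \<in> verts X" "fork_path A y = q" "suspended_depths A q = Some (depth A y)"
    and q: "\<And>x. x \<in> verts X \<Longrightarrow> fork_path A x = q \<Longrightarrow> precedes X x y"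
    and down: "\<And>z. z \<in> running_vertices l \<union> running_vertices r \<Longrightarrow> precedes X y z"
    and sep: "separated X A y (q @ [L]) r" "separated X A y (q @ [R]) l"
    and ok: "tree_order_ok X A (q @ [L]) l" "tree_order_ok X A (q @ [R]) r"
    using assms(1) by auto
  have run: "running_vertices l \<subseteq> verts X" "running_vertices r \<subseteq> verts X"
    using running_vertices_ok[OF ok(1)] running_vertices_ok[OF ok(2)] by blast+
  have U: "precedes X y z" if "z \<in> U" for z
    using that assms(3,5) down by blast
  \<comment> \<open>The event touches only the entry for \<open>c\<close>, a proper extension of
    \<open>q\<close>, so the entry for \<open>q\<close> survives.\<close>
  have "c \<noteq> q"
    using assms(2) by (auto simp: prefix_def)
  then have susp: "suspended_depths A' q = Some (depth A' y)"
    using y suspended_old depth_old by simp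
  have far: "\<not> prefix (q @ [e]) c" "\<not> prefix c (q @ [e])" if "e \<noteq> d" for e
    using assms(2) that by (auto simp: prefix_def)
  have path: "\<forall>x \<in> verts X'. fork_path A' x = q \<longrightarrow> precedes X' x y"
  proof (intro ballI impI)
    fix x assume x: "x \<in> verts X'" "fork_path A' x = q"
    then have "x \<notin> N"
      using fork_path_new assms(2) not_prefix_snoc_self prefix_order.trans by metis
    then show "precedes X' x y"
      using x q y(1) by (auto simp: verts' fork_path_old precedes_old)
  qed
  have down': "\<forall>z \<in> running_vertices l' \<union> running_vertices r'. precedes X' y z"
  proof
    fix z assume "z \<in> running_vertices l' \<union> running_vertices r'"
    then have "z \<in> running_vertices l \<union> running_vertices r \<or> z \<in> N"
      using assms(3,6) by auto
    then show "precedes X' y z"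
      using run down precedes_old precedes_new[OF y(1)] U U_nonempty by blast
  qed
  from assms(3) have "separated X' A' y (q @ [L]) r' \<and> separated X' A' y (q @ [R]) l' \<and>
     tree_order_ok X' A' (q @ [L]) l' \<and> tree_order_ok X' A' (q @ [R]) r'"
  proof
    assume d: "d = L \<and> r' = r \<and> s = l \<and> s' = l'"
    then show ?thesis
      using separated_extend_near[OF sep(1) y(1) run(2) U]
        separated_extend_far[OF sep(2) y(1) run(1) far] assms(4-6)
        tree_order_ok_frame[OF ok(2) far] by simp
  next
    assume d: "d = R \<and> l' = l \<and> s = r \<and> s' = r'"
    then show ?thesis
      using separated_extend_near[OF sep(2) y(1) run(1) U]
        separated_extend_far[OF sep(1) y(1) run(2) far] assms(4-6)
        tree_order_ok_frame[OF ok(1) far] by simp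
  qed
  then show ?thesis
    using y(1,2) susp path down' by (simp add: verts' fork_path_old)
qed

end

section \<open>Forks and joins preserve the invariant\<close>

lemma tree_fork_running:
  assumes "tree_fork u v w t t'"
  shows "u \<in> running_vertices t" "running_vertices t' \<subseteq> running_vertices t \<union> {v, w}"
  using assms by (induction rule: tree_fork.induct) auto

lemma tree_join_running:
  assumes "tree_join u v x t t'"
  shows "{u, v} \<subseteq> running_vertices t" "running_vertices t' \<subseteq> running_vertices t \<union> {x}"
  using assms by (induction rule: tree_join.induct) auto

text \<open>The prefix part of the conclusion is carried through the induction because
  \<open>tree_order_ok_extend_node\<close> has to know on which side the event lies.\<close>

lemma tree_order_ok_fork:
  assumes "tree_fork u v w t t'" "tree_order_ok X A q t"
    and "dag_extension X X' A A' {u} {v, w} (fork_path A u)"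
    and "fork_path A' v = fork_path A u @ [L]" "fork_path A' w = fork_path A u @ [R]"
    and "suspended_depths A' (fork_path A u) = Some (depth A u)"
  shows "prefix q (fork_path A u) \<and> tree_order_ok X' A' q t'"
proof -
  interpret dag_extension X X' A A' "{u}" "{v, w}" "fork_path A u"
    by (fact assms(3))
  show ?thesis
    using assms(1,2)
  proof (induction arbitrary: q rule: tree_fork.induct)
    case fork_here
    then have u: "u \<in> verts X" "fork_path A u = q"
      and le: "\<And>x. x \<in> verts X \<Longrightarrow> prefix q (fork_path A x) \<Longrightarrow> precedes X x u"
      by auto
    have q: "fork_path A' v = q @ [L]" "fork_path A' w = q @ [R]"
      using assms(4,5) u(2) by auto
    have old: "precedes X' x u" "precedes X' x v" "precedes X' x w"
      if "x \<in> verts X" "prefix q (fork_path A x)" for x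
      using le[OF that] precedes_old[OF u(1)] precedes_new[OF that(1)] by auto
    \<comment> \<open>Old vertices below \<open>q\<close> precede \<open>u\<close> by the leaf
      condition, which gives the first alternative. The only new vertex left is the sibling of
      \<open>z\<close>, and it does not reach \<open>z\<close>.\<close>
    have sep: "separated X' A' u (q @ [d]) (Leaf z)"
      if z: "z \<in> {v, w}" "\<not> prefix (q @ [d]) (fork_path A' z)" for d z
      unfolding separated_def
    proof (intro ballI impI)
      fix x assume x: "x \<in> verts X'" "prefix (q @ [d]) (fork_path A' x)"
      show "precedes X' x u \<or>
        precedes X' u x \<and> x \<noteq> u \<and> (\<forall>z \<in> running_vertices (Leaf z). \<not> precedes X' x z)"
      proof (cases "x \<in> verts X")
        case True
        then show ?thesis using old(1) x(2) fork_path_old append_prefixD by metis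
      next
        case False
        then have N: "x \<in> {v, w}"
          using x(1) verts' by blast
        moreover have "x \<noteq> z"
          using x(2) z(2) by blast
        ultimately show ?thesis
          using not_precedes_new_new[OF N z(1)] precedes_new[OF u(1) N] u(1) False
          by (auto simp: precedes_refl)
      qed
    qed
    have "separated X' A' u (q @ [L]) (Leaf w)" "separated X' A' u (q @ [R]) (Leaf v)"
      using sep[of w L] sep[of v R] q by (auto simp: prefix_def)
    moreover have "precedes X' x u" if "x \<in> verts X'" "fork_path A' x = q" for x
    proof -
      have "x \<in> verts X"
        using that q verts' by auto
      then show ?thesis
        using old(1) that(2) fork_path_old by simp
    qed
    \<comment> \<open>Leaf condition for the children: old vertices reach \<open>z\<close> through
      \<open>u\<close>, and the only new vertex on this side is \<open>z\<close> itself.\<close>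
    moreover have "precedes X' x z"
      if "x \<in> verts X'" "prefix (q @ [d]) (fork_path A' x)" "z \<in> {v, w}"
        "fork_path A' z = q @ [d]" for x z d
    proof (cases "x \<in> verts X")
      case True
      then have "prefix q (fork_path A x)"
        using that(2) fork_path_old append_prefixD by metis
      then show ?thesis
        using old(2,3) True that(3) by blast
    next
      case False
      then have "x \<in> {v, w}"
        using that(1) verts' by blast
      then have "x = z"
        using that(2-4) q by auto
      then show ?thesis
        by (simp add: precedes_refl)
    qed
    moreover have "suspended_depths A' q = Some (depth A' u)" "fork_path A' u = q"
      using u assms(6) depth_old fork_path_old by auto
    moreover have "precedes X' u v" "precedes X' u w"
      using old u by auto
    ultimately show ?case
      using u q by (auto simp: verts')
  next
    case (fork_left l l' y r)
    then have IH: "prefix (q @ [L]) (fork_path A u)" "tree_order_ok X' A' (q @ [L]) l'"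
      by auto
    then show ?case
      using tree_order_ok_extend_node[OF fork_left.prems IH(1) _ IH(2)]
        tree_fork_running[OF fork_left.hyps] by (auto dest: append_prefixD)
  next
    case (fork_right r r' y l)
    then have IH: "prefix (q @ [R]) (fork_path A u)" "tree_order_ok X' A' (q @ [R]) r'"
      by auto
    then show ?case
      using tree_order_ok_extend_node[OF fork_right.prems IH(1) _ IH(2)]
        tree_fork_running[OF fork_right.hyps] by (auto dest: append_prefixD)
  qed
qed

lemma tree_order_ok_join:
  assumes "tree_join u v x t t'" "tree_order_ok X A q t"
    and "dag_extension X X' A A' {u, v} {x} c"
    and "fork_path A u = c @ [L]" "fork_path A' x = c"
  shows "prefix q c \<and> tree_order_ok X' A' q t'"
proof -
  interpret dag_extension X X' A A' "{u, v}" "{x}" c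
    by (fact assms(3))
  show ?thesis
    using assms(1,2)
  proof (induction arbitrary: q rule: tree_join.induct)
    case (join_here y)
    then have q: "q = c"
      using assms(4) by simp
    \<comment> \<open>The leaf conditions of \<open>u\<close> and \<open>v\<close> cover the paths
      that extend \<open>q @ [L]\<close> and \<open>q @ [R]\<close>; a vertex with path exactly
      \<open>q\<close> precedes \<open>y\<close> and hence \<open>u\<close>. So everything below
      \<open>q\<close> reaches the join vertex.\<close>
    have "precedes X z u \<or> precedes X z v" if "z \<in> verts X" "prefix q (fork_path A z)" for z
      using that(2)
    proof (cases rule: prefix_cases_dir)
      case 1
      then have "precedes X z y" "precedes X y u"
        using join_here that(1) by auto
      then show ?thesis by (blast intro: precedes_trans)
    qed (use join_here that(1) in auto)
    then have "precedes X' z x" if "z \<in> verts X" "prefix q (fork_path A z)" for z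
      using that precedes_new by auto
    then show ?case
      using q assms(5) precedes_refl by (auto simp: verts' fork_path_old)
  next
    case (join_left l l' y r)
    then have IH: "prefix (q @ [L]) c" "tree_order_ok X' A' (q @ [L]) l'"
      by auto
    then show ?case
      using tree_order_ok_extend_node[OF join_left.prems IH(1) _ IH(2)]
        tree_join_running[OF join_left.hyps] by (auto dest: append_prefixD)
  next
    case (join_right r r' y l)
    then have IH: "prefix (q @ [R]) c" "tree_order_ok X' A' (q @ [R]) r'"
      by auto
    then show ?case
      using tree_order_ok_extend_node[OF join_right.prems IH(1) _ IH(2)]
        tree_join_running[OF join_right.hyps] by (auto dest: append_prefixD)
  qed
qed

lemma depa_run_tree_order_ok:
  assumes "depa_run X A"
  shows "tree_order_ok X A [] (tasks X)"
  using assms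
proof (induction rule: depa_run.induct)
  case (run_init r)
  then show ?case
    by (simp add: initial_execution_def initial_depa_def precedes_refl)
next
  case (run_step X A e X')
  have E: "edges X \<subseteq> verts X \<times> verts X"
    and T: "tree_paths_ok (verts X) (fork_path A) [] (tasks X)"
    using depa_run_invariant[OF run_step.hyps(1)] by auto
  from run_step.hyps(2) show ?case
  proof cases
    case (step_fork u v w t)
    have u: "u \<in> verts X"
      using tree_paths_ok_fork[OF step_fork(3) T step_fork(4-6)] by blast
    have "dag_extension X X' A (depa_update e A) {u} {v, w} (fork_path A u)"
      by unfold_locales (use E u step_fork in auto)
    from tree_order_ok_fork[OF step_fork(3) run_step.IH this] show ?thesis
      using step_fork by auto
  next
    case (step_join u v x t)
    then obtain c where c: "fork_path A u = c @ [L]" and uv: "u \<in> verts X" "v \<in> verts X"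
      using tree_paths_ok_join[OF step_join(3) T step_join(4)] by auto
    have "dag_extension X X' A (depa_update e A) {u, v} {x} c"
      by unfold_locales (use E uv c step_join in \<open>auto simp: Let_def\<close>)
    from tree_order_ok_join[OF step_join(3) run_step.IH this c] show ?thesis
      using step_join c by (auto simp: Let_def)
  qed
qed

section \<open>Correctness of the query\<close>

text \<open>A longest path ending at \<open>a\<close>, prolonged by a path from \<open>a\<close> to
  \<open>b\<close>, bounds the depth of \<open>b\<close> from below; the second path is nonempty if
  \<open>a \<noteq> b\<close>.\<close>

lemma depth_mono:
  assumes "depa_run X A" "a \<in> verts X" "b \<in> verts X" "precedes X a b"
  shows "depth A a \<le> depth A b" "a \<noteq> b \<Longrightarrow> depth A a < depth A b"
proof -
  have a: "is_depth (edges X) a (depth A a)" and b: "is_depth (edges X) b (depth A b)"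
    using depa_run_invariant assms by blast+
  obtain n where n: "(a, b) \<in> edges X ^^ n"
    using assms(4) unfolding precedes_def rtrancl_power by blast
  obtain r where "(r, a) \<in> edges X ^^ depth A a"
    using a unfolding is_depth_def by blast
  then have "(r, b) \<in> edges X ^^ (depth A a + n)"
    using n unfolding relpow_add by blast
  then have le: "depth A a + n \<le> depth A b"
    using b unfolding is_depth_def by blast
  then show "depth A a \<le> depth A b"
    by simp
  show "depth A a < depth A b" if "a \<noteq> b"
    using le n that by (cases n) auto
qed

lemma longest_common_prefix_branch:
  assumes "prefix q xs" "prefix (q @ [d]) ys" "\<not> prefix (q @ [d]) xs"
  shows "longest_common_prefix xs ys = q"
proof -
  obtain zs where ys: "ys = q @ d # zs"
    using assms(2) by (auto simp: prefix_def)
  obtain ws where xs: "xs = q @ ws"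
    using assms(1) by (auto simp: prefix_def)
  have "longest_common_prefix (q @ ws) (q @ d # zs) = q @ longest_common_prefix ws (d # zs)"
    by (induction q) auto
  moreover have "longest_common_prefix ws (d # zs) = []"
    using assms(3) xs by (cases ws) (auto simp: prefix_def)
  ultimately show ?thesis
    using xs ys by simp
qed

text \<open>Here the fork-path of \<open>u\<close> leaves that of \<open>v\<close> at the suspended
  vertex \<open>y\<close>. If \<open>u\<close> precedes \<open>y\<close>, both sides of the
  equivalence are true. Otherwise both are false: \<open>u\<close> is a strict descendant of
  \<open>y\<close>, so its depth exceeds the stored one.\<close>

lemma depa_query_branch:
  assumes run: "depa_run X A" and y: "y \<in> verts X" "suspended_depths A q = Some (depth A y)"
    and v: "precedes X y v" "v \<in> verts X" "prefix (q @ [d]) (fork_path A v)"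
    and u: "u \<in> verts X" "prefix q (fork_path A u)" "\<not> prefix (q @ [d]) (fork_path A u)"
    and order: "precedes X u y \<or> precedes X y u \<and> u \<noteq> y \<and> \<not> precedes X u v"
  shows "depa_query A u v = Some (precedes X u v)"
proof -
  have "longest_common_prefix (fork_path A u) (fork_path A v) = q"
    using longest_common_prefix_branch[OF u(2) v(3) u(3)] .
  moreover have "q \<noteq> fork_path A v"
    using v(3) not_prefix_snoc_self by metis
  ultimately have "depa_query A u v = Some (depth A u \<le> depth A y)"
    by (simp add: depa_query_def y(2))
  moreover have "depth A u \<le> depth A y \<longleftrightarrow> precedes X u v"
    using order
  proof
    assume "precedes X u y"
    then show ?thesis
      using depth_mono(1)[OF run u(1) y(1)] precedes_trans[OF _ v(1)] by simp
  next
    assume "precedes X y u \<and> u \<noteq> y \<and> \<not> precedes X u v"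
    then show ?thesis
      using depth_mono(2)[OF run y(1) u(1)] by auto
  qed
  ultimately show ?thesis
    by simp
qed

text \<open>Descend from the root towards \<open>v\<close> while the fork-path of \<open>u\<close>
  follows. At the first deviation \<open>depa_query_branch\<close> applies; if the leaf is reached,
  \<open>u\<close> precedes \<open>v\<close> by the leaf condition and the depth comparison succeeds
  by monotonicity.\<close>

lemma depa_query_correct:
  assumes run: "depa_run X A" and u: "u \<in> verts X"
    and "tree_order_ok X A q t" "v \<in> running_vertices t" "prefix q (fork_path A u)"
  shows "depa_query A u v = Some (precedes X u v)"
  using assms(3-5)
proof (induction t arbitrary: q)
  case (Leaf v')
  then have v: "v \<in> verts X" "fork_path A v = q" "precedes X u v"
    using u by auto
  then have "longest_common_prefix (fork_path A u) (fork_path A v) = fork_path A v"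
    using Leaf.prems(3) longest_common_prefix_max_prefix longest_common_prefix_prefix2
    by (metis prefix_order.antisym prefix_order.refl)
  then show ?case
    using v depth_mono(1)[OF run u v(1,3)] by (simp add: depa_query_def)
next
  case (Node y l r)
  then have y: "y \<in> verts X" "suspended_depths A q = Some (depth A y)" "precedes X y v"
    and ok: "tree_order_ok X A (q @ [L]) l" "tree_order_ok X A (q @ [R]) r"
    and sep: "separated X A y (q @ [L]) r" "separated X A y (q @ [R]) l"
    and q: "fork_path A u = q \<Longrightarrow> precedes X u y"
    using u by auto
  from Node.prems(2) consider "v \<in> running_vertices l" | "v \<in> running_vertices r"
    by auto
  then show ?case
  proof cases
    case 1
    show ?thesis
    proof (cases "prefix (q @ [L]) (fork_path A u)")
      case True
      then show ?thesis using Node.IH(1) ok(1) 1 by blast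
    next
      case False
      \<comment> \<open>Since the side of \<open>v\<close> is excluded, the fork-path of
        \<open>u\<close> is \<open>q\<close> itself or lies on the other side, where
        \<open>separated\<close> gives the alternative.\<close>
      have "precedes X u y \<or> precedes X y u \<and> u \<noteq> y \<and> \<not> precedes X u v"
        using Node.prems(3) by (cases rule: prefix_cases_dir)
          (use q False sep(2) u 1 in \<open>auto simp: separated_def\<close>)
      then show ?thesis
        using depa_query_branch[OF run y _ _ u Node.prems(3) False] running_vertices_ok[OF ok(1) 1]
        by blast
    qed
  next
    case 2
    show ?thesis
    proof (cases "prefix (q @ [R]) (fork_path A u)")
      case True
      then show ?thesis using Node.IH(2) ok(2) 2 by blast
    next
      case False
      have "precedes X u y \<or> precedes X y u \<and> u \<noteq> y \<and> \<not> precedes X u v"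
        using Node.prems(3) by (cases rule: prefix_cases_dir)
          (use q False sep(1) u 2 in \<open>auto simp: separated_def\<close>)
      then show ?thesis
        using depa_query_branch[OF run y _ _ u Node.prems(3) False] running_vertices_ok[OF ok(2) 2]
        by blast
    qed
  qed
qed

theorem theorem3p3:
  fixes X :: "'v execution" and A :: "'v depa" and u v :: 'v
  assumes "depa_run X A"
    and "v \<in> running_vertices (tasks X)"
    and "u \<in> verts X" and "u \<noteq> v"
  shows "depa_query A u v = Some (precedes X u v)"
  using depa_query_correct[OF assms(1,3) depa_run_tree_order_ok[OF assms(1)] assms(2)] by simp

end
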